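(* Let $u$ be a positive invariant harmonic function defined in the unit ball $B^n\subset\mathbb{C}^n$ by a positive Borel measure $\mu$ on $S^{n-1}=\partial B^n$ with the Poisson-Szegő kernel $P_\alpha$, $\alpha\in\mathbb{R}$, that is, $u(z)=\int_{S^{n-1}}P_\alpha(z,\eta)\,d\mu(\eta)$ for $z\in B^n$. Let $\zeta\in S^{n-1}$ be given. (1) If $\alpha>-n$, then the function $\dfrac{(1-r)^{n}}{(1+r)^{n+2\alpha}}u(r\zeta)$ is decreasing for $0\le r<1$, and the function $\dfrac{(1+r)^{n}}{(1-r)^{n+2\alpha}}u(r\zeta)$ is increasing for $0\le r<1$. (2) If $\alpha<-n$, then the function $\dfrac{(1-r)^{n}}{(1+r)^{n+2\alpha}}u(r\zeta)$ is increasing for $0\le r<1$, and the function $\dfrac{(1+r)^{n}}{(1-r)^{n+2\alpha}}u(r\zeta)$ is decreasing for $0\le r<1$. (3) Also, $$\lim_{r\to 1}(1-r)^{n}u(r\zeta)=\begin{cases}2^{n+2\alpha}\mu(\{\zeta\}), & \alpha>-n,\\ \infty, & \alpha<-n,\ \mu(\{\zeta\}^c)>0,\\ 2^{n+2\alpha}\mu(\{\zeta\}), & \alpha<-n,\ \mu(\{\zeta\}^c)=0,\end{cases}$$ (4) and $$\lim_{r\to 1}\frac{u(r\zeta)}{(1-r)^{n+2\alpha}}=\int_{S^{n-1}}\frac{2^{n+2\alpha}}{|\zeta-\eta|^{2n+2\alpha}}\,d\mu(\eta).$$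
   Context: $B^n$ is the open unit ball in $\mathbb{C}^n$ and $S^{n-1}=\partial B^n$ denotes its boundary sphere. For $z,\zeta\in\mathbb{C}^n$, $z\cdot\overline\zeta=\sum_{i=1}^n z_i\overline{\zeta_i}$. The Poisson-Szegő kernel is $P_\alpha(z,\zeta)=\dfrac{(1-|z|^2)^{n+2\alpha}}{|1-z\cdot\overline\zeta|^{2n+2\alpha}}$, $\alpha\in\mathbb{R}$, for $z\in B^n$, $\zeta\in S^{n-1}$. It is the kernel for the operator $\Delta_{\alpha,\beta}=4(1-|z|^2)\left\{\sum_{i,j}(\delta_{i,j}-z_i\overline{z_j})\frac{\partial^2}{\partial z_i\partial\overline{z_j}}+\alpha\sum_j z_j\frac{\partial}{\partial z_j}+\beta\sum_j\overline{z_j}\frac{\partial}{\partial\overline{z_j}}-\alpha\beta\right\}$ with $\alpha=\beta$; invariant harmonic functions are the solutions of $\Delta_{\alpha,\alpha}u=0$. $\{\zeta\}^c=S^{n-1}\setminus\{\zeta\}$, and limits as $r\to1$ are taken with $0\le r<1$.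
   Formalization: In (4), |ζ−η| is replaced by |1−ζ·conj η|, the modulus in the kernel P_α; with the Euclidean distance the formula fails for n≥2, e.g. n=2, α=0, ζ=e1, μ a unit mass at e2 (limit 4, integral 1). The two agree for n=1. *)

theory Defs
  imports "HOL-Analysis.Analysis"
begin

definition hdot :: "complex ^ 'n \<Rightarrow> complex ^ 'n \<Rightarrow> complex" where
  "hdot z w = (\<Sum>i\<in>UNIV. z $ i * cnj (w $ i))"

definition poisson_szego :: "real \<Rightarrow> complex ^ 'n \<Rightarrow> complex ^ 'n \<Rightarrow> real" where
  "poisson_szego \<alpha> z \<zeta> =
     (1 - (norm z)\<^sup>2) powr (real CARD('n) + 2 * \<alpha>)
       / cmod (1 - hdot z \<zeta>) powr (2 * real CARD('n) + 2 * \<alpha>)"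

text \<open>
  Wirtinger derivatives: with \<open>z\<^sub>j = x\<^sub>j + \<i> y\<^sub>j\<close>, the real directions \<open>x\<^sub>j\<close> and \<open>y\<^sub>j\<close> are
  \<open>axis j 1\<close> and \<open>axis j \<i>\<close>.
\<close>

definition wirtinger :: "'n \<Rightarrow> (complex ^ 'n \<Rightarrow> complex) \<Rightarrow> complex ^ 'n \<Rightarrow> complex" where
  "wirtinger j f z =
     (frechet_derivative f (at z) (axis j 1) - \<i> * frechet_derivative f (at z) (axis j \<i>)) / 2"

definition wirtinger_bar :: "'n \<Rightarrow> (complex ^ 'n \<Rightarrow> complex) \<Rightarrow> complex ^ 'n \<Rightarrow> complex" where
  "wirtinger_bar j f z =
     (frechet_derivative f (at z) (axis j 1) + \<i> * frechet_derivative f (at z) (axis j \<i>)) / 2"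

definition Delta_op ::
    "real \<Rightarrow> real \<Rightarrow> (complex ^ 'n \<Rightarrow> complex) \<Rightarrow> complex ^ 'n \<Rightarrow> complex" where
  "Delta_op \<alpha> \<beta> f z =
     4 * of_real (1 - (norm z)\<^sup>2) *
       ((\<Sum>i\<in>UNIV. \<Sum>j\<in>UNIV. ((if i = j then 1 else 0) - z $ i * cnj (z $ j))
            * wirtinger i (wirtinger_bar j f) z)
        + of_real \<alpha> * (\<Sum>j\<in>UNIV. z $ j * wirtinger j f z)
        + of_real \<beta> * (\<Sum>j\<in>UNIV. cnj (z $ j) * wirtinger_bar j f z)
        - of_real (\<alpha> * \<beta>) * f z)"

text \<open>
  Twice continuously differentiable in the real sense, expressed through the directional derivatives
  \<open>x \<mapsto> Df(x) v\<close>.  The set \<open>S\<close> is meant to be open.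
\<close>

definition C2_on :: "(complex ^ 'n) set \<Rightarrow> (complex ^ 'n \<Rightarrow> complex) \<Rightarrow> bool" where
  "C2_on S f \<longleftrightarrow>
     (\<forall>z\<in>S. f differentiable (at z)) \<and>
     (\<forall>v. \<forall>z\<in>S. (\<lambda>x. frechet_derivative f (at x) v) differentiable (at z)) \<and>
     (\<forall>v w. continuous_on S
        (\<lambda>z. frechet_derivative (\<lambda>x. frechet_derivative f (at x) v) (at z) w))"

definition invariant_harmonic :: "real \<Rightarrow> (complex ^ 'n \<Rightarrow> real) \<Rightarrow> bool" where
  "invariant_harmonic \<alpha> u \<longleftrightarrow>
     C2_on (ball 0 1) (\<lambda>z. complex_of_real (u z)) \<and>
     (\<forall>z\<in>ball 0 1. Delta_op \<alpha> \<alpha> (\<lambda>z. complex_of_real (u z)) z = 0)"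

text \<open>
  The power \<open>x\<^sup>a\<close> of a real \<open>x \<ge> 0\<close> with values in \<open>[0, \<infinity>]\<close>: at \<open>x = 0\<close> it is \<open>\<infinity>\<close>, \<open>1\<close>, \<open>0\<close>
  according to \<open>a < 0\<close>, \<open>a = 0\<close>, \<open>a > 0\<close>, whereas \<open>0 powr a = 0\<close> for every \<open>a\<close>.
\<close>

definition epowr :: "real \<Rightarrow> real \<Rightarrow> ennreal" where
  "epowr x a =
     (if x = 0 then (if a < 0 then \<infinity> else if a = 0 then 1 else 0) else ennreal (x powr a))"

text \<open>
  Radial boundary value of \<open>poisson_szego \<alpha> (r *\<^sub>R \<zeta>) \<eta> / (1 - r) powr (n + 2 * \<alpha>)\<close> as \<open>r\<close> tends
  to \<open>1\<close>.  Its denominator is a power of \<open>|1 - \<zeta> \<cdot> cnj \<eta>|\<close>, the modulus in the denominator of the kernel.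
  This is often written \<open>|\<zeta> - \<eta>|\<close>, which is the same number on the unit circle (\<open>n = 1\<close>) but
  not on the sphere for \<open>n \<ge> 2\<close>; see the two lemmas below.  With the Euclidean distance the
  limit formula would fail for \<open>n \<ge> 2\<close>, \<open>\<alpha> \<noteq> -n\<close>: for \<open>\<mu>\<close> a unit mass at a point orthogonal to \<open>\<zeta>\<close> the limit is
  \<open>2 powr (n + 2 * \<alpha>)\<close>, while the integral would be \<open>2 powr \<alpha>\<close>.
\<close>

definition radial_kernel :: "real \<Rightarrow> complex ^ 'n \<Rightarrow> complex ^ 'n \<Rightarrow> ennreal" where
  "radial_kernel \<alpha> \<zeta> \<eta> =
     ennreal (2 powr (real CARD('n) + 2 * \<alpha>))
       / epowr (cmod (1 - hdot \<zeta> \<eta>)) (2 * real CARD('n) + 2 * \<alpha>)"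

lemma cmod_one_minus_hdot_eq_norm_diff:
  fixes \<zeta> \<eta> :: "complex ^ 'n"
  assumes "CARD('n) = 1" and "\<eta> \<in> sphere 0 1"
  shows "cmod (1 - hdot \<zeta> \<eta>) = norm (\<zeta> - \<eta>)"
proof -
  obtain k where k: "UNIV = {k :: 'n}"
    using assms(1) by (auto simp: card_1_singleton_iff)
  have n: "norm v = cmod (v $ k)" for v :: "complex ^ 'n"
    by (simp add: norm_vec_def L2_set_def k)
  have e1: "cmod (\<eta> $ k) = 1"
    using assms(2) by (simp add: n)
  then have "\<eta> $ k * cnj (\<eta> $ k) = 1"
    by (simp add: complex_norm_square [symmetric])
  then have "1 - hdot \<zeta> \<eta> = (\<eta> $ k - \<zeta> $ k) * cnj (\<eta> $ k)"
    by (simp add: hdot_def k algebra_simps)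
  then show ?thesis
    using e1 by (simp add: n norm_mult norm_minus_commute)
qed

lemma cmod_one_minus_hdot_neq_norm_diff:
  fixes i j :: "'n::finite"
  assumes "i \<noteq> j"
  defines "\<zeta> \<equiv> axis i 1 :: complex ^ 'n" and "\<eta> \<equiv> axis j 1 :: complex ^ 'n"
  shows "\<zeta> \<in> sphere 0 1" "\<eta> \<in> sphere 0 1"
    "cmod (1 - hdot \<zeta> \<eta>) = 1" "norm (\<zeta> - \<eta>) = sqrt 2"
proof -
  show "\<zeta> \<in> sphere 0 1" "\<eta> \<in> sphere 0 1"
    by (simp_all add: \<zeta>_def \<eta>_def)
  have "hdot \<zeta> \<eta> = 0"
    using assms(1) by (auto simp: hdot_def \<zeta>_def \<eta>_def axis_def intro!: sum.neutral)
  then show "cmod (1 - hdot \<zeta> \<eta>) = 1" by simp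
  have "(norm (\<zeta> - \<eta>))\<^sup>2 = 2"
    using assms(1)
    by (simp add: \<zeta>_def \<eta>_def power2_norm_eq_inner inner_diff_left inner_diff_right inner_axis_axis)
  then show "norm (\<zeta> - \<eta>) = sqrt 2"
    by (metis norm_ge_zero real_sqrt_unique)
qed

end

theory Submission
  imports Defs
begin

text \<open>
  Fix \<open>\<zeta>\<close> and put \<open>w = \<langle>\<zeta>, \<eta>\<rangle>\<close>, so that \<open>|w| \<le> 1\<close>, and \<open>p = 2n + 2\<alpha>\<close>.  On the radius through \<open>\<zeta>\<close>
  the factor \<open>1 - |z|\<^sup>2\<close> of the kernel splits as \<open>(1 - r)(1 + r)\<close>, and the two weights in the
  theorem are exactly those that turn the kernel into the \<open>p\<close>-th power of one quotient:
  \<open>(1 - r)\<^sup>n / (1 + r)\<^bsup>n+2\<alpha>\<^esup> \<cdot> P = ((1 - r) / |1 - r w|)\<^sup>p\<close> and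
  \<open>(1 + r)\<^sup>n / (1 - r)\<^bsup>n+2\<alpha>\<^esup> \<cdot> P = (|1 - r w| / (1 + r))\<^bsup>-p\<^esup>\<close>.

  For every \<open>|w| \<le> 1\<close> both quotients are positive and decrease in \<open>r\<close>, starting from \<open>1\<close> at \<open>r = 0\<close>
  (lemmas \<open>lower_ratio_decreasing\<close> and \<open>upper_ratio_decreasing\<close>).  The reason is that \<open>1 - r w\<close> is a
  combination of \<open>1 - w\<close> and \<open>1 + w\<close> with nonnegative coefficients, and that these two numbers enclose an
  angle of at most \<open>\<pi>/2\<close>.  Integration over \<open>\<mu>\<close> preserves this, so both weighted functions are
  monotone, in a direction given by the sign of \<open>p\<close>, that is, of \<open>\<alpha> + n\<close>.

  The same monotonicity yields the limits: at \<open>r = 1\<close> the integral commutes with the limit by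
  monotone convergence, upwards without further conditions, and downwards because \<open>\<mu>\<close> is finite
  (its mass is \<open>u(0)\<close>).  The first quotient tends to \<open>0\<close>, except at \<open>\<eta> = \<zeta>\<close>, where it is constantly
  \<open>1\<close>; so the limit measures \<open>{\<zeta>}\<close> if \<open>p > 0\<close> and is infinite off \<open>\<zeta>\<close> if \<open>p < 0\<close>.  The second
  tends to \<open>|1 - w| / 2\<close>, which gives the radial kernel.
\<close>

section \<open>Two decreasing quotients on the unit disc\<close>

text \<open>
  Moving along a direction that makes an angle of at most \<open>\<pi>/2\<close> with the starting vector leads
  away from the origin: the squared norm is a quadratic polynomial with nonnegative coefficients.
\<close>

lemma norm_add_scaleR_mono:
  fixes a b :: "'a::real_inner"
  assumes "inner a b \<ge> 0" "0 \<le> s" "s \<le> t"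
  shows "norm (a + s *\<^sub>R b) \<le> norm (a + t *\<^sub>R b)"
proof -
  have expand: "(norm (a + x *\<^sub>R b))\<^sup>2 = (norm a)\<^sup>2 + 2 * (x * inner a b) + x\<^sup>2 * (norm b)\<^sup>2" for x
    unfolding power2_norm_eq_inner
    by (simp add: inner_add_left inner_add_right inner_commute algebra_simps power2_eq_square)
  have "s * inner a b \<le> t * inner a b" "s\<^sup>2 * (norm b)\<^sup>2 \<le> t\<^sup>2 * (norm b)\<^sup>2"
    using assms by (auto intro!: mult_right_mono power_mono)
  then have "(norm (a + s *\<^sub>R b))\<^sup>2 \<le> (norm (a + t *\<^sub>R b))\<^sup>2"
    unfolding expand by linarith
  then show ?thesis
    by (rule power2_le_imp_le) (rule norm_ge_zero)
qed

text \<open>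
  By the theorem of Thales, the segment from \<open>-1\<close> to \<open>1\<close> is seen from a point of the disc under an
  angle of at least \<open>\<pi>/2\<close>; hence \<open>1 - w\<close> and \<open>1 + w\<close> enclose at most \<open>\<pi>/2\<close>.
\<close>

lemma inner_one_minus_one_plus:
  fixes w :: complex
  assumes "cmod w \<le> 1"
  shows "inner (1 - w) (1 + w) \<ge> 0"
proof -
  have "inner (1 - w) (1 + w) = 1 - (cmod w)\<^sup>2"
    unfolding cmod_power2 by (simp add: inner_complex_def algebra_simps power2_eq_square)
  then show ?thesis
    using assms by (simp add: power_le_one)
qed

definition lower_ratio :: "complex \<Rightarrow> real \<Rightarrow> real" where
  "lower_ratio w r = (1 - r) / cmod (1 - of_real r * w)"

definition upper_ratio :: "complex \<Rightarrow> real \<Rightarrow> real" where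
  "upper_ratio w r = cmod (1 - of_real r * w) / (1 + r)"

lemma cmod_one_minus_mult_pos:
  assumes "cmod w \<le> 1" "0 \<le> r" "r < 1"
  shows "cmod (1 - of_real r * w) > 0"
proof -
  have "cmod (of_real r * w) \<le> r"
    using assms by (simp add: norm_mult mult_left_le)
  then show ?thesis
    using assms by auto
qed

lemma lower_ratio_pos: "cmod w \<le> 1 \<Longrightarrow> 0 \<le> r \<Longrightarrow> r < 1 \<Longrightarrow> lower_ratio w r > 0"
  and upper_ratio_pos: "cmod w \<le> 1 \<Longrightarrow> 0 \<le> r \<Longrightarrow> r < 1 \<Longrightarrow> upper_ratio w r > 0"
  using cmod_one_minus_mult_pos[of w r] by (auto simp: lower_ratio_def upper_ratio_def)

text \<open>
  The reciprocal of the quotient is the length of \<open>((1 + w) + t (1 - w)) / 2\<close> with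
  \<open>t = (1 + r) / (1 - r)\<close>, and \<open>t\<close> increases with \<open>r\<close>.
\<close>

lemma lower_ratio_decreasing:
  assumes "cmod w \<le> 1" "0 \<le> r" "r \<le> s" "s < 1"
  shows "lower_ratio w s \<le> lower_ratio w r"
proof -
  define t where "t x = (1 + x) / (1 - x)" for x :: real
  have eq: "lower_ratio w x = 2 / cmod ((1 + w) + t x *\<^sub>R (1 - w))" if "x < 1" for x
  proof -
    have split: "1 - of_real x * w = ((1 - x) / 2) *\<^sub>R ((1 + w) + t x *\<^sub>R (1 - w))"
      using that by (simp add: t_def complex_eq_iff) (simp add: field_simps)
    have scaled: "cmod (1 - of_real x * w) = (1 - x) / 2 * cmod ((1 + w) + t x *\<^sub>R (1 - w))"
      unfolding split norm_scaleR using that by simp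
    have "(1 - x) / ((1 - x) / 2 * c) = 2 / c" for c
      using that by (simp add: divide_simps)
    then show ?thesis
      unfolding lower_ratio_def scaled .
  qed
  have "r < 1"
    using assms by simp
  have "0 \<le> t r" "t r \<le> t s"
    using assms unfolding t_def by (auto intro!: frac_le)
  then have le: "cmod ((1 + w) + t r *\<^sub>R (1 - w)) \<le> cmod ((1 + w) + t s *\<^sub>R (1 - w))"
    using inner_one_minus_one_plus[OF assms(1)]
    by (intro norm_add_scaleR_mono) (simp_all add: inner_commute)
  have pos: "0 < cmod ((1 + w) + t r *\<^sub>R (1 - w))"
    using lower_ratio_pos[OF assms(1,2) \<open>r < 1\<close>]
    unfolding eq[OF \<open>r < 1\<close>] by (simp add: zero_less_divide_iff)
  show ?thesis
    unfolding eq[OF \<open>r < 1\<close>] eq[OF \<open>s < 1\<close>]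
    by (rule frac_le[OF zero_le_numeral order_refl pos le])
qed

text \<open>
  Here the quotient itself is the length of \<open>((1 - w) + t (1 + w)) / 2\<close> with
  \<open>t = (1 - r) / (1 + r)\<close>, and \<open>t\<close> decreases with \<open>r\<close>.
\<close>

lemma upper_ratio_decreasing:
  assumes "cmod w \<le> 1" "0 \<le> r" "r \<le> s" "s < 1"
  shows "upper_ratio w s \<le> upper_ratio w r"
proof -
  define t where "t x = (1 - x) / (1 + x)" for x :: real
  have eq: "upper_ratio w x = cmod ((1 - w) + t x *\<^sub>R (1 + w)) / 2" if "0 \<le> x" for x
  proof -
    have split: "1 - of_real x * w = ((1 + x) / 2) *\<^sub>R ((1 - w) + t x *\<^sub>R (1 + w))"
      using that by (simp add: t_def complex_eq_iff) (simp add: field_simps)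
    have scaled: "cmod (1 - of_real x * w) = (1 + x) / 2 * cmod ((1 - w) + t x *\<^sub>R (1 + w))"
      unfolding split norm_scaleR using that by simp
    have "(1 + x) / 2 * c / (1 + x) = c / 2" for c
      using that by (simp add: divide_simps)
    then show ?thesis
      unfolding upper_ratio_def scaled .
  qed
  have "0 \<le> t s" "t s \<le> t r"
    using assms unfolding t_def by (auto intro!: frac_le)
  then have "cmod ((1 - w) + t s *\<^sub>R (1 + w)) \<le> cmod ((1 - w) + t r *\<^sub>R (1 + w))"
    using inner_one_minus_one_plus[OF assms(1)] by (intro norm_add_scaleR_mono)
  then show ?thesis
    using assms by (simp add: eq)
qed

lemma tendsto_lower_ratio:
  "(lower_ratio w \<longlongrightarrow> (if w = 1 then 1 else 0)) (at_left 1)"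
proof (cases "w = 1")
  case True
  have "\<forall>\<^sub>F r in at_left 1. lower_ratio w r = 1"
  proof (rule eventually_at_leftI[of 0])
    fix r :: real
    assume "r \<in> {0<..<1}"
    then have "cmod (of_real (1 - r)) = 1 - r"
      unfolding norm_of_real by simp
    then show "lower_ratio w r = 1"
      using \<open>r \<in> {0<..<1}\<close> by (simp add: lower_ratio_def True)
  qed simp
  then show ?thesis
    using True by (simp add: tendsto_eventually)
next
  case False
  then have "((\<lambda>r. (1 - r) / cmod (1 - of_real r * w)) \<longlongrightarrow> (1 - 1) / cmod (1 - of_real 1 * w)) (at_left 1)"
    by (intro tendsto_intros) auto
  then show ?thesis
    using False by (simp add: lower_ratio_def [abs_def])
qed

lemma tendsto_upper_ratio:
  "(upper_ratio w \<longlongrightarrow> cmod (1 - w) / 2) (at_left 1)"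
proof -
  have "((\<lambda>r. cmod (1 - of_real r * w) / (1 + r)) \<longlongrightarrow> cmod (1 - of_real 1 * w) / (1 + 1)) (at_left 1)"
    by (intro tendsto_intros) auto
  then show ?thesis
    by (simp add: upper_ratio_def [abs_def])
qed

section \<open>Integrals of powers of a decreasing family\<close>

text \<open>
  The conventions for \<open>epowr\<close> at \<open>0\<close> are those that make it the continuous extension of the real
  power in the base.
\<close>

lemma tendsto_ennreal_powr_epowr:
  fixes x :: "'b \<Rightarrow> real"
  assumes lim: "(x \<longlongrightarrow> c) F" and pos: "\<forall>\<^sub>F t in F. x t > 0"
  shows "((\<lambda>t. ennreal (x t powr a)) \<longlongrightarrow> epowr c a) F"
proof (cases "c = 0")
  case False
  then show ?thesis
    using tendsto_powr[OF lim tendsto_const[of a] False] by (simp add: epowr_def)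
next
  case c: True
  consider "a > 0" | "a = 0" | "a < 0" by linarith
  then show ?thesis
  proof cases
    case 1
    have "((\<lambda>t. x t powr a) \<longlongrightarrow> c powr a) F"
      using pos 1 lim by (intro tendsto_powr') (auto elim: eventually_mono)
    then have "((\<lambda>t. ennreal (x t powr a)) \<longlongrightarrow> ennreal (c powr a)) F"
      by (rule tendsto_ennrealI)
    then show ?thesis
      using 1 c by (simp add: epowr_def)
  next
    case 2
    have "\<forall>\<^sub>F t in F. ennreal (x t powr a) = 1"
      using pos by eventually_elim (simp add: 2)
    then show ?thesis
      using 2 c by (simp add: epowr_def tendsto_eventually)
  next
    case 3
    have "filterlim (\<lambda>t. inverse (x t powr - a)) at_top F"
    proof (rule filterlim_inverse_at_top)
      have "((\<lambda>t. x t powr - a) \<longlongrightarrow> c powr - a) F"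
        using pos 3 lim by (intro tendsto_powr') (auto elim: eventually_mono)
      then show "((\<lambda>t. x t powr - a) \<longlongrightarrow> 0) F"
        using c by simp
      show "\<forall>\<^sub>F t in F. 0 < x t powr - a"
        using pos by eventually_elim simp
    qed
    then have "filterlim (\<lambda>t. x t powr a) at_top F"
      by (simp add: powr_minus)
    then show ?thesis
      using 3 c by (simp add: epowr_def ennreal_tendsto_top_eq_at_top)
  qed
qed

lemma borel_measurable_epowr: "(\<lambda>x. epowr x a) \<in> borel_measurable borel"
  unfolding epowr_def
  by (intro measurable_If measurable_const measurable_compose[OF _ measurable_ennreal]) measurable

text \<open>
  A limit from the left can be tested on increasing sequences.  Along such a sequence the integrands
  are monotone, so the theorem of monotone convergence applies.
\<close>

lemma nn_integral_mono_convergence_at_left: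
  fixes f :: "real \<Rightarrow> 'a \<Rightarrow> ennreal" and a b :: real
  assumes "a < b"
    and meas: "\<And>r. r \<in> {a..<b} \<Longrightarrow> f r \<in> borel_measurable M"
    and mono: "\<And>x. x \<in> space M \<Longrightarrow> mono_on {a..<b} (\<lambda>r. f r x)"
    and lim: "\<And>x. x \<in> space M \<Longrightarrow> ((\<lambda>r. f r x) \<longlongrightarrow> g x) (at_left b)"
  shows "((\<lambda>r. \<integral>\<^sup>+x. f r x \<partial>M) \<longlongrightarrow> (\<integral>\<^sup>+x. g x \<partial>M)) (at_left b)"
proof (rule tendsto_at_left_sequentially[OF \<open>a < b\<close>])
  fix S :: "nat \<Rightarrow> real"
  assume S: "\<And>n. S n < b" "\<And>n. a < S n" "incseq S" "S \<longlonglongrightarrow> b"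
  have S_in: "S n \<in> {a..<b}" for n
    using S(1,2)[of n] by simp
  have S_lim: "filterlim S (at_left b) sequentially"
    using S by (auto simp: filterlim_at less_imp_neq[OF S(1)])
  have inc: "incseq (\<lambda>n. f (S n) x)" if "x \<in> space M" for x
    by (intro incseq_SucI mono_onD[OF mono[OF that]] S_in incseq_SucD[OF S(3)])
  have "(\<integral>\<^sup>+x. g x \<partial>M) = (\<integral>\<^sup>+x. (SUP n. f (S n) x) \<partial>M)"
  proof (rule nn_integral_cong)
    fix x
    assume x: "x \<in> space M"
    show "g x = (SUP n. f (S n) x)"
      by (rule LIMSEQ_unique[OF filterlim_compose[OF lim[OF x] S_lim] LIMSEQ_SUP[OF inc[OF x]]])
  qed
  also have "\<dots> = (SUP n. \<integral>\<^sup>+x. f (S n) x \<partial>M)"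
    using inc by (intro nn_integral_monotone_convergence_SUP_AE meas S_in AE_I2)
      (auto dest: incseq_SucD)
  finally have eq: "(\<integral>\<^sup>+x. g x \<partial>M) = (SUP n. \<integral>\<^sup>+x. f (S n) x \<partial>M)" .
  have "incseq (\<lambda>n. \<integral>\<^sup>+x. f (S n) x \<partial>M)"
    using inc by (intro incseq_SucI nn_integral_mono) (auto dest: incseq_SucD)
  then show "(\<lambda>n. \<integral>\<^sup>+x. f (S n) x \<partial>M) \<longlonglongrightarrow> (\<integral>\<^sup>+x. g x \<partial>M)"
    unfolding eq by (rule LIMSEQ_SUP)
qed

lemma nn_integral_antimono_convergence_at_left:
  fixes f :: "real \<Rightarrow> 'a \<Rightarrow> ennreal" and a b :: real
  assumes "a < b"
    and meas: "\<And>r. r \<in> {a..<b} \<Longrightarrow> f r \<in> borel_measurable M"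
    and anti: "\<And>x. x \<in> space M \<Longrightarrow> antimono_on {a..<b} (\<lambda>r. f r x)"
    and fin: "(\<integral>\<^sup>+x. f a x \<partial>M) < \<infinity>"
    and lim: "\<And>x. x \<in> space M \<Longrightarrow> ((\<lambda>r. f r x) \<longlongrightarrow> g x) (at_left b)"
  shows "((\<lambda>r. \<integral>\<^sup>+x. f r x \<partial>M) \<longlongrightarrow> (\<integral>\<^sup>+x. g x \<partial>M)) (at_left b)"
proof (rule tendsto_at_left_sequentially[OF \<open>a < b\<close>])
  fix S :: "nat \<Rightarrow> real"
  assume S: "\<And>n. S n < b" "\<And>n. a < S n" "incseq S" "S \<longlonglongrightarrow> b"
  have S_in: "S n \<in> {a..<b}" for n
    using S(1,2)[of n] by simp
  have S_lim: "filterlim S (at_left b) sequentially"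
    using S by (auto simp: filterlim_at less_imp_neq[OF S(1)])
  have dec: "decseq (\<lambda>n. f (S n) x)" if "x \<in> space M" for x
    by (intro decseq_SucI monotone_onD[OF anti[OF that]] S_in incseq_SucD[OF S(3)])
  have "(\<integral>\<^sup>+x. f (S 0) x \<partial>M) \<le> (\<integral>\<^sup>+x. f a x \<partial>M)"
    using S(2)[of 0] \<open>a < b\<close>
    by (intro nn_integral_mono monotone_onD[OF anti]) (auto simp: S(1))
  then have fin0: "(\<integral>\<^sup>+x. f (S 0) x \<partial>M) < \<infinity>"
    using fin by (rule order.strict_trans1)
  have "(\<integral>\<^sup>+x. g x \<partial>M) = (\<integral>\<^sup>+x. (INF n. f (S n) x) \<partial>M)"
  proof (rule nn_integral_cong)
    fix x
    assume x: "x \<in> space M"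
    show "g x = (INF n. f (S n) x)"
      by (rule LIMSEQ_unique[OF filterlim_compose[OF lim[OF x] S_lim] LIMSEQ_INF[OF dec[OF x]]])
  qed
  also have "\<dots> = (INF n. \<integral>\<^sup>+x. f (S n) x \<partial>M)"
    using dec fin0 by (intro nn_integral_monotone_convergence_INF_AE' meas S_in AE_I2)
      (auto dest: decseq_SucD)
  finally have eq: "(\<integral>\<^sup>+x. g x \<partial>M) = (INF n. \<integral>\<^sup>+x. f (S n) x \<partial>M)" .
  have "decseq (\<lambda>n. \<integral>\<^sup>+x. f (S n) x \<partial>M)"
    using dec by (intro decseq_SucI nn_integral_mono) (auto dest: decseq_SucD)
  then show "(\<lambda>n. \<integral>\<^sup>+x. f (S n) x \<partial>M) \<longlonglongrightarrow> (\<integral>\<^sup>+x. g x \<partial>M)"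
    unfolding eq by (rule LIMSEQ_INF)
qed

text \<open>
  The next two lemmas are applied to both quotients, with \<open>p\<close> and \<open>-p\<close> as exponents; \<open>F\<close> stands for
  a weighted radial restriction of \<open>u\<close>.
\<close>

lemma powr_integral_monotone:
  fixes \<rho> :: "real \<Rightarrow> 'a \<Rightarrow> real" and F :: "real \<Rightarrow> real"
  assumes pos: "\<And>r x. r \<in> I \<Longrightarrow> x \<in> space M \<Longrightarrow> \<rho> r x > 0"
    and dec: "\<And>x. x \<in> space M \<Longrightarrow> antimono_on I (\<lambda>r. \<rho> r x)"
    and F: "\<And>r. r \<in> I \<Longrightarrow> ennreal (F r) = (\<integral>\<^sup>+x. ennreal (\<rho> r x powr a) \<partial>M)"
    and F_nonneg: "\<And>r. r \<in> I \<Longrightarrow> F r \<ge> 0"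
  shows "a \<ge> 0 \<Longrightarrow> antimono_on I F"
    and "a \<le> 0 \<Longrightarrow> mono_on I F"
proof -
  have le: "F r \<le> F s"
    if "r \<in> I" "s \<in> I" "\<And>x. x \<in> space M \<Longrightarrow> \<rho> r x powr a \<le> \<rho> s x powr a" for r s
  proof -
    have "ennreal (F r) \<le> ennreal (F s)"
      unfolding F[OF that(1)] F[OF that(2)]
      by (intro nn_integral_mono ennreal_leI that(3))
    then show ?thesis
      using F_nonneg[OF that(2)] by (simp add: ennreal_le_iff)
  qed
  show "antimono_on I F" if "a \<ge> 0"
    using that pos monotone_onD[OF dec]
    by (intro monotone_onI le powr_mono2) (auto intro: less_imp_le)
  show "mono_on I F" if "a \<le> 0"
    using that pos monotone_onD[OF dec]
    by (intro monotone_onI le powr_mono2') auto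
qed

lemma powr_integral_tendsto:
  fixes \<rho> :: "real \<Rightarrow> 'a \<Rightarrow> real"
  assumes meas: "\<And>r. r \<in> {0..<1} \<Longrightarrow> \<rho> r \<in> borel_measurable M"
    and pos: "\<And>r x. r \<in> {0..<1} \<Longrightarrow> x \<in> space M \<Longrightarrow> \<rho> r x > 0"
    and dec: "\<And>x. x \<in> space M \<Longrightarrow> antimono_on {0..<1} (\<lambda>r. \<rho> r x)"
    and lim: "\<And>x. x \<in> space M \<Longrightarrow> ((\<lambda>r. \<rho> r x) \<longlongrightarrow> c x) (at_left 1)"
    and fin: "(\<integral>\<^sup>+x. ennreal (\<rho> 0 x powr a) \<partial>M) < \<infinity>"
  shows "((\<lambda>r. \<integral>\<^sup>+x. ennreal (\<rho> r x powr a) \<partial>M) \<longlongrightarrow> (\<integral>\<^sup>+x. epowr (c x) a \<partial>M)) (at_left 1)"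
proof -
  have lim': "((\<lambda>r. ennreal (\<rho> r x powr a)) \<longlongrightarrow> epowr (c x) a) (at_left 1)" if "x \<in> space M" for x
    by (intro tendsto_ennreal_powr_epowr lim that eventually_at_leftI[of 0] pos) auto
  have meas': "(\<lambda>x. ennreal (\<rho> r x powr a)) \<in> borel_measurable M" if "r \<in> {0..<1}" for r
    using meas[OF that] by measurable
  show ?thesis
  proof (cases "a \<ge> 0")
    case True
    have "antimono_on {0..<1} (\<lambda>r. ennreal (\<rho> r x powr a))" if "x \<in> space M" for x
      using True pos that monotone_onD[OF dec[OF that]]
      by (intro monotone_onI ennreal_leI powr_mono2) (auto intro: less_imp_le)
    then show ?thesis
      by (intro nn_integral_antimono_convergence_at_left[of 0] meas' lim' fin) auto
  next
    case False
    have "mono_on {0..<1} (\<lambda>r. ennreal (\<rho> r x powr a))" if "x \<in> space M" for x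
      using False pos that monotone_onD[OF dec[OF that]]
      by (intro monotone_onI ennreal_leI powr_mono2') auto
    then show ?thesis
      by (intro nn_integral_mono_convergence_at_left[of 0] meas' lim') auto
  qed
qed

section \<open>The kernel on a radius\<close>

lemma Re_hdot: "Re (hdot z w) = inner z w"
  by (simp add: hdot_def inner_vec_def inner_complex_def)

lemma hdot_scaleR_left: "hdot (r *\<^sub>R z) w = of_real r * hdot z w"
  by (simp add: hdot_def sum_distrib_left mult.assoc scaleR_conv_of_real[where 'a = complex])

lemma cmod_hdot_le: "cmod (hdot z w) \<le> norm z * norm w"
proof -
  have "cmod (hdot z w) \<le> (\<Sum>i\<in>UNIV. \<bar>cmod (z $ i)\<bar> * \<bar>cmod (w $ i)\<bar>)"
    unfolding hdot_def by (intro sum_norm_le) (simp add: norm_mult)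
  also have "\<dots> \<le> norm z * norm w"
    unfolding norm_vec_def by (rule L2_set_mult_ineq)
  finally show ?thesis .
qed

text \<open>
  The case of equality in the Cauchy-Schwarz inequality: the squared distance of two unit vectors
  is \<open>2 - 2 Re \<langle>z, w\<rangle>\<close>.
\<close>

lemma hdot_eq_1_iff:
  assumes "norm z = 1" "norm w = 1"
  shows "hdot z w = 1 \<longleftrightarrow> z = w"
proof
  assume "hdot z w = 1"
  then have "inner z w = 1"
    by (simp flip: Re_hdot)
  then have "(norm (z - w))\<^sup>2 = 0"
    using assms by (simp add: power2_norm_eq_inner norm_eq_1 inner_diff inner_commute)
  then show "z = w"
    by simp
next
  assume "z = w"
  moreover have "hdot z z = of_real ((norm z)\<^sup>2)"
    by (simp add: hdot_def norm_vec_def L2_set_def sum_nonneg complex_norm_square del: of_real_power)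
  ultimately show "hdot z w = 1"
    using assms by simp
qed

lemma borel_measurable_hdot: "hdot z \<in> borel_measurable borel"
  unfolding hdot_def [abs_def]
  by (intro borel_measurable_continuous_onI continuous_intros)

lemma poisson_szego_radial:
  fixes \<zeta> \<eta> :: "complex ^ 'n"
  defines "n \<equiv> real CARD('n)"
  assumes "norm \<zeta> = 1" "0 \<le> r" "r < 1"
  shows "poisson_szego \<alpha> (r *\<^sub>R \<zeta>) \<eta>
           = (1 - r) powr (n + 2 * \<alpha>) * (1 + r) powr (n + 2 * \<alpha>)
               / cmod (1 - of_real r * hdot \<zeta> \<eta>) powr (2 * n + 2 * \<alpha>)"
proof -
  have "1 - (norm (r *\<^sub>R \<zeta>))\<^sup>2 = (1 - r) * (1 + r)"
    using assms by (simp add: power2_eq_square algebra_simps)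
  then show ?thesis
    using assms by (simp add: poisson_szego_def hdot_scaleR_left powr_mult)
qed

lemma poisson_szego_radial_lower:
  fixes \<zeta> \<eta> :: "complex ^ 'n"
  defines "n \<equiv> real CARD('n)"
  assumes "norm \<zeta> = 1" "0 \<le> r" "r < 1"
  shows "(1 - r) powr n / (1 + r) powr (n + 2 * \<alpha>) * poisson_szego \<alpha> (r *\<^sub>R \<zeta>) \<eta>
           = lower_ratio (hdot \<zeta> \<eta>) r powr (2 * n + 2 * \<alpha>)"
proof -
  have "(1 - r) powr n * (1 - r) powr (n + 2 * \<alpha>) = (1 - r) powr (2 * n + 2 * \<alpha>)"
    by (simp add: powr_add [symmetric])
  then show ?thesis
    using assms poisson_szego_radial[of \<zeta> r \<alpha> \<eta>] by (simp add: lower_ratio_def powr_divide)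
qed

lemma poisson_szego_radial_upper:
  fixes \<zeta> \<eta> :: "complex ^ 'n"
  defines "n \<equiv> real CARD('n)"
  assumes "norm \<zeta> = 1" "0 \<le> r" "r < 1"
  shows "(1 + r) powr n / (1 - r) powr (n + 2 * \<alpha>) * poisson_szego \<alpha> (r *\<^sub>R \<zeta>) \<eta>
           = upper_ratio (hdot \<zeta> \<eta>) r powr - (2 * n + 2 * \<alpha>)"
proof -
  have "(1 + r) powr n * (1 + r) powr (n + 2 * \<alpha>) = (1 + r) powr (2 * n + 2 * \<alpha>)"
    by (simp add: powr_add [symmetric])
  then show ?thesis
    using assms poisson_szego_radial[of \<zeta> r \<alpha> \<eta>] unfolding powr_minus
    by (simp add: upper_ratio_def powr_divide)
qed

text \<open>
  At \<open>\<langle>\<zeta>, \<eta>\<rangle> = 1\<close> the three signs of the exponent need separate treatment: passing from a divisor to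
  a factor with the opposite exponent exchanges the values \<open>0\<close> and \<open>\<infinity>\<close> of \<open>epowr\<close>.
\<close>

lemma radial_kernel_eq_epowr:
  fixes \<zeta> \<eta> :: "complex ^ 'n"
  defines "n \<equiv> real CARD('n)"
  shows "radial_kernel \<alpha> \<zeta> \<eta>
           = ennreal (2 powr - n) * epowr (cmod (1 - hdot \<zeta> \<eta>) / 2) (- (2 * n + 2 * \<alpha>))"
proof (cases "hdot \<zeta> \<eta> = 1")
  case True
  consider "n + \<alpha> > 0" | "n + \<alpha> = 0" | "n + \<alpha> < 0" by linarith
  then show ?thesis
  proof cases
    case 1
    then show ?thesis
      using True by (simp add: radial_kernel_def epowr_def n_def [symmetric] ennreal_mult_top)
  next
    case 2
    then have "\<alpha> = - n" by simp
    then show ?thesis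
      using True by (simp add: radial_kernel_def epowr_def n_def [symmetric] divide_ennreal_def)
  next
    case 3
    then show ?thesis
      using True by (simp add: radial_kernel_def epowr_def n_def [symmetric])
  qed
next
  case False
  define c where "c = cmod (1 - hdot \<zeta> \<eta>)"
  have c: "c > 0"
    using False by (auto simp: c_def)
  have "2 powr (n + 2 * \<alpha>) / c powr (2 * n + 2 * \<alpha>) = 2 powr - n * (c / 2) powr (- (2 * n + 2 * \<alpha>))"
  proof -
    have "(2::real) powr - n * 2 powr (2 * n + 2 * \<alpha>) = 2 powr (n + 2 * \<alpha>)"
      by (simp add: powr_add [symmetric])
    then show ?thesis
      using c unfolding powr_minus[of "c / 2"] by (simp add: powr_divide)
  qed
  then show ?thesis
    using c by (simp add: radial_kernel_def epowr_def c_def [symmetric] n_def [symmetric]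
        divide_ennreal ennreal_mult [symmetric])
qed

section \<open>Monotonicity and radial limits\<close>

theorem theorem1p8:
  fixes u :: "complex ^ 'n \<Rightarrow> real"
    and \<mu> :: "(complex ^ 'n) measure"
    and \<alpha> :: real
    and \<zeta> :: "complex ^ 'n"
  defines "n \<equiv> real CARD('n)"
  assumes mu: "sets \<mu> = sets (restrict_space borel (sphere 0 1))"
    and u_pos: "\<And>z. z \<in> ball 0 1 \<Longrightarrow> u z > 0"
    and u_harm: "invariant_harmonic \<alpha> u"
    and u_eq: "\<And>z. z \<in> ball 0 1 \<Longrightarrow>
                 ennreal (u z) = (\<integral>\<^sup>+ \<eta>. ennreal (poisson_szego \<alpha> z \<eta>) \<partial>\<mu>)"
    and zeta: "\<zeta> \<in> sphere 0 1"
  shows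
    "(\<alpha> > - n \<longrightarrow>
        antimono_on {0..<1} (\<lambda>r. (1 - r) powr n / (1 + r) powr (n + 2 * \<alpha>) * u (r *\<^sub>R \<zeta>)) \<and>
        mono_on {0..<1} (\<lambda>r. (1 + r) powr n / (1 - r) powr (n + 2 * \<alpha>) * u (r *\<^sub>R \<zeta>))) \<and>
     (\<alpha> < - n \<longrightarrow>
        mono_on {0..<1} (\<lambda>r. (1 - r) powr n / (1 + r) powr (n + 2 * \<alpha>) * u (r *\<^sub>R \<zeta>)) \<and>
        antimono_on {0..<1} (\<lambda>r. (1 + r) powr n / (1 - r) powr (n + 2 * \<alpha>) * u (r *\<^sub>R \<zeta>))) \<and>
     (\<alpha> > - n \<longrightarrow>
        ((\<lambda>r. (1 - r) powr n * u (r *\<^sub>R \<zeta>)) \<longlongrightarrow> 2 powr (n + 2 * \<alpha>) * measure \<mu> {\<zeta>}) (at_left 1)) \<and>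
     (\<alpha> < - n \<and> emeasure \<mu> (sphere 0 1 - {\<zeta>}) > 0 \<longrightarrow>
        filterlim (\<lambda>r. (1 - r) powr n * u (r *\<^sub>R \<zeta>)) at_top (at_left 1)) \<and>
     (\<alpha> < - n \<and> emeasure \<mu> (sphere 0 1 - {\<zeta>}) = 0 \<longrightarrow>
        ((\<lambda>r. (1 - r) powr n * u (r *\<^sub>R \<zeta>)) \<longlongrightarrow> 2 powr (n + 2 * \<alpha>) * measure \<mu> {\<zeta>}) (at_left 1)) \<and>
     ((\<lambda>r. ennreal (u (r *\<^sub>R \<zeta>) / (1 - r) powr (n + 2 * \<alpha>))) \<longlongrightarrow>
        (\<integral>\<^sup>+ \<eta>. radial_kernel \<alpha> \<zeta> \<eta> \<partial>\<mu>)) (at_left 1)"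
proof -
  define p where "p = 2 * n + 2 * \<alpha>"
  define lower where "lower = (\<lambda>r \<eta>. lower_ratio (hdot \<zeta> \<eta>) r)"
  define upper where "upper = (\<lambda>r \<eta>. upper_ratio (hdot \<zeta> \<eta>) r)"
  define L where "L r = (1 - r) powr n / (1 + r) powr (n + 2 * \<alpha>) * u (r *\<^sub>R \<zeta>)" for r
  define U where "U r = (1 + r) powr n / (1 - r) powr (n + 2 * \<alpha>) * u (r *\<^sub>R \<zeta>)" for r

  have norm_\<zeta>: "norm \<zeta> = 1"
    using zeta by simp
  have space: "space \<mu> = sphere 0 1"
    using sets_eq_imp_space_eq[OF mu] by (simp add: space_restrict_space)
  have cmod_hdot: "cmod (hdot \<zeta> \<eta>) \<le> 1" if "\<eta> \<in> space \<mu>" for \<eta>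
    using cmod_hdot_le[of \<zeta> \<eta>] that norm_\<zeta> by (simp add: space)
  have meas_hdot: "hdot \<zeta> \<in> borel_measurable \<mu>"
    using measurable_restrict_space1[OF borel_measurable_hdot[of \<zeta>], where \<Omega> = "sphere 0 1"]
    by (simp add: measurable_cong_sets[OF mu refl])
  have meas_sets: "A \<inter> sphere 0 1 \<in> sets \<mu>" if "A \<in> sets borel" for A
    using that by (auto simp: mu sets_restrict_space)
  have \<zeta>_set: "{\<zeta>} \<in> sets \<mu>" and off_\<zeta>_set: "sphere 0 1 - {\<zeta>} \<in> sets \<mu>"
    using meas_sets[of "{\<zeta>}"] meas_sets[of "- {\<zeta>}"] zeta by (simp_all add: Diff_eq Int_commute)

  \<comment> \<open>The kernel is \<open>1\<close> at the centre, so the total mass is \<open>u 0\<close>.\<close>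
  have "emeasure \<mu> (space \<mu>) = ennreal (u 0)"
    by (simp add: u_eq poisson_szego_def hdot_def)
  then have "emeasure \<mu> {\<zeta>} \<le> ennreal (u 0)"
    using emeasure_space[of \<mu> "{\<zeta>}"] by simp
  then have mass_\<zeta>: "emeasure \<mu> {\<zeta>} = ennreal (measure \<mu> {\<zeta>})"
    by (intro emeasure_eq_ennreal_measure) (auto simp: top_unique)

  have u_radial: "u (r *\<^sub>R \<zeta>) > 0" if "r \<in> {0..<1}" for r
    using that norm_\<zeta> by (intro u_pos) simp
  have meas_kernel: "(\<lambda>\<eta>. ennreal (poisson_szego \<alpha> (r *\<^sub>R \<zeta>) \<eta>)) \<in> borel_measurable \<mu>" for r
    unfolding poisson_szego_def hdot_scaleR_left using meas_hdot by measurable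
  have weighted: "ennreal (k * u (r *\<^sub>R \<zeta>)) = (\<integral>\<^sup>+\<eta>. ennreal (f \<eta>) \<partial>\<mu>)"
    if "r \<in> {0..<1}" "k \<ge> 0" "\<And>\<eta>. norm \<eta> = 1 \<Longrightarrow> k * poisson_szego \<alpha> (r *\<^sub>R \<zeta>) \<eta> = f \<eta>" for r k f
  proof -
    have "ennreal (k * u (r *\<^sub>R \<zeta>)) = ennreal k * (\<integral>\<^sup>+\<eta>. ennreal (poisson_szego \<alpha> (r *\<^sub>R \<zeta>) \<eta>) \<partial>\<mu>)"
      using that(1,2) norm_\<zeta> u_radial[OF that(1)] by (subst u_eq [symmetric]) (auto simp: ennreal_mult)
    also have "\<dots> = (\<integral>\<^sup>+\<eta>. ennreal k * ennreal (poisson_szego \<alpha> (r *\<^sub>R \<zeta>) \<eta>) \<partial>\<mu>)"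
      by (rule nn_integral_cmult[OF meas_kernel, symmetric])
    also have "\<dots> = (\<integral>\<^sup>+\<eta>. ennreal (f \<eta>) \<partial>\<mu>)"
      using that(2,3)
      by (intro nn_integral_cong) (auto simp: space poisson_szego_def ennreal_mult [symmetric])
    finally show ?thesis .
  qed
  have L_eq: "ennreal (L r) = (\<integral>\<^sup>+\<eta>. ennreal (lower r \<eta> powr p) \<partial>\<mu>)" if "r \<in> {0..<1}" for r
    unfolding L_def lower_def p_def n_def
    using that norm_\<zeta> by (intro weighted poisson_szego_radial_lower) auto
  have U_eq: "ennreal (U r) = (\<integral>\<^sup>+\<eta>. ennreal (upper r \<eta> powr - p) \<partial>\<mu>)" if "r \<in> {0..<1}" for r
    unfolding U_def upper_def p_def n_def
    using that norm_\<zeta> by (intro weighted poisson_szego_radial_upper) auto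
  have L_nonneg: "L r \<ge> 0" and U_nonneg: "U r \<ge> 0" if "r \<in> {0..<1}" for r
    using u_radial[OF that] by (simp_all add: L_def U_def)

  have lower_pos: "lower r \<eta> > 0" and upper_pos: "upper r \<eta> > 0"
    if "r \<in> {0..<1}" "\<eta> \<in> space \<mu>" for r \<eta>
    using that cmod_hdot[OF that(2)]
    by (auto simp: lower_def upper_def intro: lower_ratio_pos upper_ratio_pos)
  have lower_dec: "antimono_on {0..<1} (\<lambda>r. lower r \<eta>)"
    and upper_dec: "antimono_on {0..<1} (\<lambda>r. upper r \<eta>)" if "\<eta> \<in> space \<mu>" for \<eta>
    using cmod_hdot[OF that] unfolding lower_def upper_def
    by (auto intro!: monotone_onI lower_ratio_decreasing upper_ratio_decreasing)
  have meas_lower: "lower r \<in> borel_measurable \<mu>" and meas_upper: "upper r \<in> borel_measurable \<mu>" for r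
    unfolding lower_def upper_def lower_ratio_def upper_ratio_def using meas_hdot by measurable

  have L_antimono: "p \<ge> 0 \<Longrightarrow> antimono_on {0..<1} L" and L_mono: "p \<le> 0 \<Longrightarrow> mono_on {0..<1} L"
    using powr_integral_monotone[OF lower_pos lower_dec L_eq L_nonneg] by auto
  have U_antimono: "p \<le> 0 \<Longrightarrow> antimono_on {0..<1} U" and U_mono: "p \<ge> 0 \<Longrightarrow> mono_on {0..<1} U"
    using powr_integral_monotone[OF upper_pos upper_dec U_eq U_nonneg] by auto

  have near_1: "\<forall>\<^sub>F r in at_left 1. r \<in> {0..<1::real}"
    by (rule eventually_at_leftI[of 0]) auto

  \<comment> \<open>The first quotient is constantly \<open>1\<close> at \<open>\<zeta>\<close> and vanishes in the limit everywhere else.\<close>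
  define at_\<zeta> where "at_\<zeta> \<eta> = (if \<eta> = \<zeta> then 1 else 0 :: real)" for \<eta>
  have "((\<lambda>r. \<integral>\<^sup>+\<eta>. ennreal (lower r \<eta> powr p) \<partial>\<mu>) \<longlongrightarrow> (\<integral>\<^sup>+\<eta>. epowr (at_\<zeta> \<eta>) p \<partial>\<mu>)) (at_left 1)"
  proof (rule powr_integral_tendsto[OF meas_lower lower_pos lower_dec])
    fix \<eta>
    assume "\<eta> \<in> space \<mu>"
    then have "at_\<zeta> \<eta> = (if hdot \<zeta> \<eta> = 1 then 1 else 0)"
      using hdot_eq_1_iff[of \<zeta> \<eta>] norm_\<zeta> by (auto simp: at_\<zeta>_def space)
    then show "((\<lambda>r. lower r \<eta>) \<longlongrightarrow> at_\<zeta> \<eta>) (at_left 1)"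
      using tendsto_lower_ratio[of "hdot \<zeta> \<eta>"] by (simp add: lower_def)
  next
    show "(\<integral>\<^sup>+\<eta>. ennreal (lower 0 \<eta> powr p) \<partial>\<mu>) < \<infinity>"
      using L_eq[of 0, symmetric] by simp
  qed
  then have L_lim: "((\<lambda>r. ennreal (L r)) \<longlongrightarrow> (\<integral>\<^sup>+\<eta>. epowr (at_\<zeta> \<eta>) p \<partial>\<mu>)) (at_left 1)"
    by (rule Lim_transform_eventually) (use near_1 in \<open>eventually_elim; simp add: L_eq\<close>)

  have "((\<lambda>r. \<integral>\<^sup>+\<eta>. ennreal (upper r \<eta> powr - p) \<partial>\<mu>)
          \<longlongrightarrow> (\<integral>\<^sup>+\<eta>. epowr (cmod (1 - hdot \<zeta> \<eta>) / 2) (- p) \<partial>\<mu>)) (at_left 1)"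
  proof (rule powr_integral_tendsto[OF meas_upper upper_pos upper_dec])
    show "((\<lambda>r. upper r \<eta>) \<longlongrightarrow> cmod (1 - hdot \<zeta> \<eta>) / 2) (at_left 1)" for \<eta>
      using tendsto_upper_ratio[of "hdot \<zeta> \<eta>"] by (simp add: upper_def)
    show "(\<integral>\<^sup>+\<eta>. ennreal (upper 0 \<eta> powr - p) \<partial>\<mu>) < \<infinity>"
      using U_eq[of 0, symmetric] by simp
  qed
  then have U_lim: "((\<lambda>r. ennreal (U r))
      \<longlongrightarrow> (\<integral>\<^sup>+\<eta>. epowr (cmod (1 - hdot \<zeta> \<eta>) / 2) (- p) \<partial>\<mu>)) (at_left 1)"
    by (rule Lim_transform_eventually) (use near_1 in \<open>eventually_elim; simp add: U_eq\<close>)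

  \<comment> \<open>The limits in the theorem differ from these by a power of \<open>1 + r\<close>, which is continuous at \<open>1\<close>.\<close>
  have plus_lim: "((\<lambda>r. (1 + r) powr a) \<longlongrightarrow> 2 powr a) (at_left 1)" for a :: real
  proof -
    have "((\<lambda>r. (1 + r) powr a) \<longlongrightarrow> (1 + 1) powr a) (at_left (1::real))"
      by (intro tendsto_intros) auto
    then show ?thesis by simp
  qed
  have L_weight: "\<forall>\<^sub>F r in at_left 1. (1 + r) powr (n + 2 * \<alpha>) * L r = (1 - r) powr n * u (r *\<^sub>R \<zeta>)"
    using near_1 by eventually_elim (simp add: L_def)
  have point_mass: "((\<lambda>r. (1 - r) powr n * u (r *\<^sub>R \<zeta>)) \<longlongrightarrow> 2 powr (n + 2 * \<alpha>) * measure \<mu> {\<zeta>}) (at_left 1)"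
    if "AE \<eta> in \<mu>. epowr (at_\<zeta> \<eta>) p = indicator {\<zeta>} \<eta>"
  proof -
    have "(\<integral>\<^sup>+\<eta>. epowr (at_\<zeta> \<eta>) p \<partial>\<mu>) = ennreal (measure \<mu> {\<zeta>})"
      using nn_integral_cong_AE[OF that] \<zeta>_set by (simp add: mass_\<zeta>)
    then have "((\<lambda>r. ennreal (L r)) \<longlongrightarrow> ennreal (measure \<mu> {\<zeta>})) (at_left 1)"
      using L_lim by simp
    then have "(L \<longlongrightarrow> measure \<mu> {\<zeta>}) (at_left 1)"
      by (rule tendsto_ennrealD) (use near_1 L_nonneg in \<open>auto elim: eventually_mono\<close>)
    then have "((\<lambda>r. (1 + r) powr (n + 2 * \<alpha>) * L r) \<longlongrightarrow> 2 powr (n + 2 * \<alpha>) * measure \<mu> {\<zeta>}) (at_left 1)"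
      by (intro tendsto_mult plus_lim)
    then show ?thesis
      by (rule Lim_transform_eventually[OF _ L_weight])
  qed

  have part_pos: "((\<lambda>r. (1 - r) powr n * u (r *\<^sub>R \<zeta>)) \<longlongrightarrow> 2 powr (n + 2 * \<alpha>) * measure \<mu> {\<zeta>}) (at_left 1)"
    if "p > 0"
    using that by (intro point_mass AE_I2) (simp add: epowr_def at_\<zeta>_def)
  have part_null: "((\<lambda>r. (1 - r) powr n * u (r *\<^sub>R \<zeta>)) \<longlongrightarrow> 2 powr (n + 2 * \<alpha>) * measure \<mu> {\<zeta>}) (at_left 1)"
    if "emeasure \<mu> (sphere 0 1 - {\<zeta>}) = 0"
  proof (rule point_mass, rule AE_I')
    show "sphere 0 1 - {\<zeta>} \<in> null_sets \<mu>"
      using that off_\<zeta>_set by (simp add: null_sets_def)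
    show "{\<eta> \<in> space \<mu>. epowr (at_\<zeta> \<eta>) p \<noteq> indicator {\<zeta>} \<eta>} \<subseteq> sphere 0 1 - {\<zeta>}"
      by (auto simp: space epowr_def at_\<zeta>_def)
  qed
  have part_infinite: "filterlim (\<lambda>r. (1 - r) powr n * u (r *\<^sub>R \<zeta>)) at_top (at_left 1)"
    if "p < 0" "emeasure \<mu> (sphere 0 1 - {\<zeta>}) > 0"
  proof -
    have "\<infinity> = (\<integral>\<^sup>+\<eta>. \<infinity> * indicator (sphere 0 1 - {\<zeta>}) \<eta> \<partial>\<mu>)"
      using that(2) unfolding nn_integral_cmult_indicator[OF off_\<zeta>_set] by (simp add: ennreal_top_mult)
    also have "\<dots> \<le> (\<integral>\<^sup>+\<eta>. epowr (at_\<zeta> \<eta>) p \<partial>\<mu>)"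
      using that(1) by (intro nn_integral_mono) (simp add: epowr_def at_\<zeta>_def indicator_def)
    finally have "((\<lambda>r. ennreal (L r)) \<longlongrightarrow> top) (at_left 1)"
      using L_lim by (simp add: top_unique)
    then have "filterlim L at_top (at_left 1)"
      by (simp add: ennreal_tendsto_top_eq_at_top)
    then have "filterlim (\<lambda>r. (1 + r) powr (n + 2 * \<alpha>) * L r) at_top (at_left 1)"
      by (intro filterlim_tendsto_pos_mult_at_top[OF plus_lim]) auto
    then show ?thesis
      using filterlim_cong[OF refl refl L_weight] by simp
  qed

  have part_kernel: "((\<lambda>r. ennreal (u (r *\<^sub>R \<zeta>) / (1 - r) powr (n + 2 * \<alpha>)))
      \<longlongrightarrow> (\<integral>\<^sup>+\<eta>. radial_kernel \<alpha> \<zeta> \<eta> \<partial>\<mu>)) (at_left 1)"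
  proof -
    have "(\<lambda>\<eta>. cmod (1 - hdot \<zeta> \<eta>) / 2) \<in> borel_measurable \<mu>"
      using meas_hdot by measurable
    then have meas: "(\<lambda>\<eta>. epowr (cmod (1 - hdot \<zeta> \<eta>) / 2) (- p)) \<in> borel_measurable \<mu>"
      by (rule measurable_compose[OF _ borel_measurable_epowr])
    have kernel_eq: "(\<integral>\<^sup>+\<eta>. radial_kernel \<alpha> \<zeta> \<eta> \<partial>\<mu>)
        = ennreal (2 powr - n) * (\<integral>\<^sup>+\<eta>. epowr (cmod (1 - hdot \<zeta> \<eta>) / 2) (- p) \<partial>\<mu>)"
      unfolding radial_kernel_eq_epowr n_def [symmetric] p_def [symmetric]
      by (rule nn_integral_cmult[OF meas])
    have lim: "((\<lambda>r. ennreal ((1 + r) powr - n) * ennreal (U r))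
        \<longlongrightarrow> (\<integral>\<^sup>+\<eta>. radial_kernel \<alpha> \<zeta> \<eta> \<partial>\<mu>)) (at_left 1)"
      unfolding kernel_eq by (intro tendsto_mult_ennreal tendsto_ennrealI plus_lim U_lim) auto
    have "\<forall>\<^sub>F r in at_left 1. ennreal ((1 + r) powr - n) * ennreal (U r)
        = ennreal (u (r *\<^sub>R \<zeta>) / (1 - r) powr (n + 2 * \<alpha>))"
      using near_1
    proof eventually_elim
      case (elim r)
      then have "(1 + r) powr - n * (1 + r) powr n = 1"
        by (simp add: powr_add [symmetric])
      then have "(1 + r) powr - n * U r = u (r *\<^sub>R \<zeta>) / (1 - r) powr (n + 2 * \<alpha>)"
        by (simp add: U_def mult.assoc [symmetric])
      then show ?case
        using U_nonneg[OF elim] by (simp add: ennreal_mult [symmetric])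
    qed
    then show ?thesis
      by (rule Lim_transform_eventually[OF lim])
  qed

  have p_sign: "\<alpha> > - n \<longleftrightarrow> p > 0" "\<alpha> < - n \<longleftrightarrow> p < 0"
    by (auto simp: p_def)
  show ?thesis
    unfolding p_sign L_def [symmetric] U_def [symmetric]
    using L_antimono L_mono U_antimono U_mono part_pos part_infinite part_null part_kernel by simp
qed

end
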